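(* Let $\mathcal{A}\in\mathbb{C}^{I(N)\times I(N)}$ be a core tensor. Then the following statements hold: (a) $\mathcal{A}^{\mathrm{core}}=\mathcal{O}$ if and only if $\mathcal{A}=\mathcal{O}$; (b) $\mathcal{A}^{\mathrm{core}}=\mathcal{A}*_N\mathcal{A}^{\dagger}$ if and only if $\mathcal{A}$ is idempotent; (c) $\mathcal{A}^{\mathrm{core}}=\mathcal{A}^{\dagger}$ if and only if $\mathcal{A}$ is EP; (d) $\mathcal{A}^{\mathrm{core}}=\mathcal{A}^{\#}$ if and only if $\mathcal{A}$ is EP; (e) $\mathcal{A}^{\mathrm{core}}=\mathcal{A}$ if and only if $\mathcal{A}$ is EP and tripotent; (f) $\mathcal{A}^{\mathrm{core}}=\mathcal{A}^{*}$ if and only if $\mathcal{A}$ is EP and a partial isometry.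
   Context: Let $I_1,\dots,I_N$ be positive integers. $\mathbb{C}^{I(N)\times I(N)}$ denotes the set of complex tensors of order $2N$ with entries $\mathcal{A}_{i_1\dots i_N j_1\dots j_N}$, where $1\le i_k,j_k\le I_k$. The Einstein product is $(\mathcal{A}*_N\mathcal{B})_{i_1\dots i_N j_1\dots j_N}=\sum_{k_1,\dots,k_N}\mathcal{A}_{i_1\dots i_N k_1\dots k_N}\mathcal{B}_{k_1\dots k_N j_1\dots j_N}$, and powers $\mathcal{A}^p$ are taken with respect to $*_N$. The conjugate transpose $\mathcal{A}^*$ is defined by $(\mathcal{A}^* )_{j_1\dots j_N i_1\dots i_N}=\overline{\mathcal{A}_{i_1\dots i_N j_1\dots j_N}}$. $\mathcal{O}$ is the zero tensor. The reshaping $\mathrm{rsh}(\mathcal{A})$ is the square matrix of size $I_1\cdots I_N$ obtained by listing the row multi-indices $(i_1,\dots,i_N)$ and the column multi-indices $(j_1,\dots,j_N)$ in the column-major order of Matlab's reshape; $\mathrm{rshrank}(\mathcal{A})$ is the rank of $\mathrm{rsh}(\mathcal{A})$. $\mathcal{A}$ is a core tensor if $\mathrm{rshrank}(\mathcal{A})=\mathrm{rshrank}(\mathcal{A}^2)$. The Moore-Penrose inverse $\mathcal{A}^{\dagger}$ is the unique $\mathcal{X}$ with $\mathcal{A}*_N\mathcal{X}*_N\mathcal{A}=\mathcal{A}$, $\mathcal{X}*_N\mathcal{A}*_N\mathcal{X}=\mathcal{X}$, $(\mathcal{A}*_N\mathcal{X})^*=\mathcal{A}*_N\mathcal{X}$,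 $(\mathcal{X}*_N\mathcal{A})^*=\mathcal{X}*_N\mathcal{A}$. The group inverse $\mathcal{A}^{\#}$ of a core tensor is the unique $\mathcal{X}$ with $\mathcal{A}*_N\mathcal{X}*_N\mathcal{A}=\mathcal{A}$, $\mathcal{X}*_N\mathcal{A}*_N\mathcal{X}=\mathcal{X}$, $\mathcal{A}*_N\mathcal{X}=\mathcal{X}*_N\mathcal{A}$. The core inverse $\mathcal{A}^{\mathrm{core}}$ of a core tensor is the unique $\mathcal{X}$ with $\mathcal{X}*_N\mathcal{A}^2=\mathcal{A}$, $\mathcal{A}*_N\mathcal{X}^2=\mathcal{X}$, $(\mathcal{A}*_N\mathcal{X})^*=\mathcal{A}*_N\mathcal{X}$. $\mathcal{A}$ is idempotent if $\mathcal{A}^2=\mathcal{A}$; tripotent if $\mathcal{A}^3=\mathcal{A}$; EP if $\mathcal{A}*_N\mathcal{A}^{\dagger}=\mathcal{A}^{\dagger}*_N\mathcal{A}$; a partial isometry if $\mathcal{A}*_N\mathcal{A}^**_N\mathcal{A}=\mathcal{A}$ (equivalently $\mathcal{A}^{\dagger}=\mathcal{A}^*$). *)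

theory Defs
  imports Complex_Main "Jordan_Normal_Form.DL_Rank"
begin

text \<open>The dimensions I_1, ..., I_N are a list of length N.  A multi-index is a list of
  the same length with 1-based entries.\<close>

definition multi_indices :: "nat list \<Rightarrow> nat list set" where
  "multi_indices I = {i. length i = length I \<and> (\<forall>k<length I. 1 \<le> i ! k \<and> i ! k \<le> I ! k)}"

type_synonym tensor = "nat list \<Rightarrow> nat list \<Rightarrow> complex"

text \<open>Entries outside the index range are required to be 0, so that equality of functions
  is equality of tensors.\<close>

definition tensors :: "nat list \<Rightarrow> tensor set" where
  "tensors I = {A. \<forall>i j. i \<notin> multi_indices I \<or> j \<notin> multi_indices I \<longrightarrow> A i j = 0}"

definition tensor_zero :: tensor where
  "tensor_zero = (\<lambda>i j. 0)"

definition tensor_one :: "nat list \<Rightarrow> tensor" where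
  "tensor_one I = (\<lambda>i j. if i \<in> multi_indices I \<and> i = j then 1 else 0)"

definition einstein :: "nat list \<Rightarrow> tensor \<Rightarrow> tensor \<Rightarrow> tensor" where
  "einstein I A B = (\<lambda>i j. \<Sum>k\<in>multi_indices I. A i k * B k j)"

primrec tensor_pow :: "nat list \<Rightarrow> tensor \<Rightarrow> nat \<Rightarrow> tensor" where
  "tensor_pow I A 0 = tensor_one I"
| "tensor_pow I A (Suc p) = einstein I (tensor_pow I A p) A"

definition conj_transpose :: "tensor \<Rightarrow> tensor" where
  "conj_transpose A = (\<lambda>j i. cnj (A i j))"

text \<open>All multi-indices in column-major order: the first component varies fastest.\<close>

fun col_major :: "nat list \<Rightarrow> nat list list" where
  "col_major [] = [[]]"
| "col_major (d # ds) = concat (map (\<lambda>is. map (\<lambda>i. i # is) [1..<Suc d]) (col_major ds))"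

lemma col_major_example:
  "col_major [2, 3] = [[1,1], [2,1], [1,2], [2,2], [1,3], [2,3]]"
  by (simp add: upt_rec)

lemma length_col_major: "length (col_major I) = prod_list I"
  by (induction I) (simp_all add: length_concat o_def sum_list_triv)

lemma set_col_major: "set (col_major I) = multi_indices I"
proof (induction I)
  case Nil
  show ?case by (auto simp: multi_indices_def)
next
  case (Cons d ds)
  show ?case
  proof (intro Set.set_eqI iffI)
    fix x assume "x \<in> set (col_major (d # ds))"
    then show "x \<in> multi_indices (d # ds)"
      using Cons by (auto simp: multi_indices_def nth_Cons split: nat.splits)
  next
    fix x assume x: "x \<in> multi_indices (d # ds)"
    then obtain i "is" where [simp]: "x = i # is"
      by (cases x) (auto simp: multi_indices_def)
    have "1 \<le> i" "i \<le> d" "is \<in> multi_indices ds"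
      using x by (auto simp: multi_indices_def nth_Cons split: nat.splits)
    then show "x \<in> set (col_major (d # ds))"
      using Cons by (auto simp del: upt_Suc intro!: bexI[of _ "is"])
  qed
qed

lemma distinct_col_major: "distinct (col_major I)"
proof (induction I)
  case (Cons d ds)
  have "distinct (concat (map (\<lambda>is. map (\<lambda>i. i # is) [1..<Suc d]) xs))"
    if "distinct xs" for xs
    using that by (induction xs) (auto simp: distinct_map inj_on_def simp del: upt_Suc)
  with Cons show ?case by simp
qed simp

definition rsh :: "nat list \<Rightarrow> tensor \<Rightarrow> complex mat" where
  "rsh I A = mat (prod_list I) (prod_list I) (\<lambda>(p, q). A (col_major I ! p) (col_major I ! q))"

definition rshrank :: "nat list \<Rightarrow> tensor \<Rightarrow> nat" where
  "rshrank I A = vec_space.rank (prod_list I) (rsh I A)"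

definition core_tensor :: "nat list \<Rightarrow> tensor \<Rightarrow> bool" where
  "core_tensor I A \<longleftrightarrow> rshrank I A = rshrank I (tensor_pow I A 2)"

definition is_moore_penrose :: "nat list \<Rightarrow> tensor \<Rightarrow> tensor \<Rightarrow> bool" where
  "is_moore_penrose I A X \<longleftrightarrow> X \<in> tensors I \<and>
     einstein I (einstein I A X) A = A \<and>
     einstein I (einstein I X A) X = X \<and>
     conj_transpose (einstein I A X) = einstein I A X \<and>
     conj_transpose (einstein I X A) = einstein I X A"

definition moore_penrose :: "nat list \<Rightarrow> tensor \<Rightarrow> tensor" where
  "moore_penrose I A = (THE X. is_moore_penrose I A X)"

definition is_group_inverse :: "nat list \<Rightarrow> tensor \<Rightarrow> tensor \<Rightarrow> bool" where
  "is_group_inverse I A X \<longleftrightarrow> X \<in> tensors I \<and>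
     einstein I (einstein I A X) A = A \<and>
     einstein I (einstein I X A) X = X \<and>
     einstein I A X = einstein I X A"

definition group_inverse :: "nat list \<Rightarrow> tensor \<Rightarrow> tensor" where
  "group_inverse I A = (THE X. is_group_inverse I A X)"

definition is_core_inverse :: "nat list \<Rightarrow> tensor \<Rightarrow> tensor \<Rightarrow> bool" where
  "is_core_inverse I A X \<longleftrightarrow> X \<in> tensors I \<and>
     einstein I X (tensor_pow I A 2) = A \<and>
     einstein I A (tensor_pow I X 2) = X \<and>
     conj_transpose (einstein I A X) = einstein I A X"

definition core_inverse :: "nat list \<Rightarrow> tensor \<Rightarrow> tensor" where
  "core_inverse I A = (THE X. is_core_inverse I A X)"

definition idempotent_tensor :: "nat list \<Rightarrow> tensor \<Rightarrow> bool" where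
  "idempotent_tensor I A \<longleftrightarrow> tensor_pow I A 2 = A"

definition tripotent_tensor :: "nat list \<Rightarrow> tensor \<Rightarrow> bool" where
  "tripotent_tensor I A \<longleftrightarrow> tensor_pow I A 3 = A"

definition EP_tensor :: "nat list \<Rightarrow> tensor \<Rightarrow> bool" where
  "EP_tensor I A \<longleftrightarrow> einstein I A (moore_penrose I A) = einstein I (moore_penrose I A) A"

definition partial_isometry_tensor :: "nat list \<Rightarrow> tensor \<Rightarrow> bool" where
  "partial_isometry_tensor I A \<longleftrightarrow> einstein I (einstein I A (conj_transpose A)) A = A"

end

theory Submission
  imports Defs "HOL-Library.Function_Algebras"
begin

text \<open>The three inverses are unique in any semigroup with involution, and the six equivalences
  hold there as soon as the inverses exist; in each case one checks that one inverse satisfies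
  the equations characterising the other. Existence is where finite dimension enters. Every tensor
  has an inner inverse, because a linear map has a linear section on its range; applied to
  A* A, together with the implication T* T = 0 ==> T = 0, this gives the Moore-Penrose inverse.
  The rank condition makes the column spaces of A and A^2 equal, so A = A^2 Z; then also A = Y A^2
  since one-sided inverses of square matrices are two-sided, and Y A Z is the group
  inverse. With G the group inverse and M the Moore-Penrose inverse, G A M is the core inverse.\<close>

section \<open>Generalized inverses in a semigroup with involution\<close>

text \<open>No unit is assumed: the intended carrier is the whole function type, on which
  \<open>tensor_one I\<close> is not neutral.\<close>

locale involutive_semigroup =
  fixes mult :: "'a \<Rightarrow> 'a \<Rightarrow> 'a"  (infixl "\<cdot>" 70)
    and star :: "'a \<Rightarrow> 'a"
  assumes mult_assoc: "a \<cdot> b \<cdot> c = a \<cdot> (b \<cdot> c)"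
    and star_mult: "star (a \<cdot> b) = star b \<cdot> star a"
    and star_star: "star (star a) = a"
begin

section \<open>The three inverses and their uniqueness\<close>

definition moore_penrose_of :: "'a \<Rightarrow> 'a \<Rightarrow> bool" where
  "moore_penrose_of a x \<longleftrightarrow> a \<cdot> x \<cdot> a = a \<and> x \<cdot> a \<cdot> x = x \<and>
     star (a \<cdot> x) = a \<cdot> x \<and> star (x \<cdot> a) = x \<cdot> a"

definition group_inverse_of :: "'a \<Rightarrow> 'a \<Rightarrow> bool" where
  "group_inverse_of a x \<longleftrightarrow> a \<cdot> x \<cdot> a = a \<and> x \<cdot> a \<cdot> x = x \<and> a \<cdot> x = x \<cdot> a"

definition core_inverse_of :: "'a \<Rightarrow> 'a \<Rightarrow> bool" where
  "core_inverse_of a x \<longleftrightarrow> x \<cdot> (a \<cdot> a) = a \<and> a \<cdot> (x \<cdot> x) = x \<and> star (a \<cdot> x) = a \<cdot> x"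

lemma moore_penrose_ofD:
  assumes "moore_penrose_of a x"
  shows "a \<cdot> x \<cdot> a = a" "x \<cdot> a \<cdot> x = x" "star (a \<cdot> x) = a \<cdot> x" "star (x \<cdot> a) = x \<cdot> a"
  using assms unfolding moore_penrose_of_def by blast+

lemma group_inverse_ofD:
  assumes "group_inverse_of a x"
  shows "a \<cdot> x \<cdot> a = a" "x \<cdot> a \<cdot> x = x" "a \<cdot> x = x \<cdot> a"
  using assms unfolding group_inverse_of_def by blast+

lemma core_inverse_ofD:
  assumes "core_inverse_of a x"
  shows "x \<cdot> (a \<cdot> a) = a" "a \<cdot> (x \<cdot> x) = x" "star (a \<cdot> x) = a \<cdot> x"
  using assms unfolding core_inverse_of_def by blast+

text \<open>Applying \<open>star\<close> to p q = q gives q p = q, while q p = p. For hermitian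
  projections: equal ranges force equality.\<close>

lemma hermitian_eq_leftI:
  assumes "star p = p" "star q = q" "p \<cdot> q = q" "q \<cdot> p = p"
  shows "p = q"
  using assms star_mult[of p q] by simp

lemma hermitian_eq_rightI:
  assumes "star p = p" "star q = q" "p \<cdot> q = p" "q \<cdot> p = q"
  shows "p = q"
  using assms star_mult[of p q] by simp

lemma moore_penrose_of_unique:
  assumes x: "moore_penrose_of a x" and y: "moore_penrose_of a y"
  shows "x = y"
proof -
  note ax = moore_penrose_ofD[OF x] and ay = moore_penrose_ofD[OF y]
  have l: "a \<cdot> x = a \<cdot> y"
    by (rule hermitian_eq_leftI[OF ax(3) ay(3)]) (simp_all only: ax ay flip: mult_assoc)
  \<comment> \<open>Associativity is oriented to the right for products headed by x or y and to the
    left for those headed by a, which exposes a x a and a y a.\<close>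
  have r: "x \<cdot> a = y \<cdot> a"
    by (rule hermitian_eq_rightI[OF ax(4) ay(4)]) (simp_all only: ax ay mult_assoc[of x] mult_assoc[of y] flip: mult_assoc[of a])
  have "x = x \<cdot> (a \<cdot> x)" using ax(2) by (simp only: mult_assoc)
  also have "\<dots> = x \<cdot> a \<cdot> y" unfolding l by (simp only: mult_assoc)
  also have "\<dots> = y" unfolding r by (rule ay)
  finally show ?thesis .
qed

lemma group_inverse_of_unique:
  assumes x: "group_inverse_of a x" and y: "group_inverse_of a y"
  shows "x = y"
proof -
  note ax = group_inverse_ofD[OF x] and ay = group_inverse_ofD[OF y]
  have "a \<cdot> x = a \<cdot> y \<cdot> (a \<cdot> x)" using ay(1) by (simp flip: mult_assoc)
  also have "\<dots> = y \<cdot> a \<cdot> (x \<cdot> a)" by (simp only: ay(3) ax(3))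
  also have "\<dots> = y \<cdot> (a \<cdot> x \<cdot> a)" by (simp add: mult_assoc)
  finally have eq: "a \<cdot> x = a \<cdot> y" by (simp add: ax(1) ay(3))
  have "x = x \<cdot> (a \<cdot> x)" using ax(2) by (simp add: mult_assoc)
  also have "\<dots> = a \<cdot> y \<cdot> y" unfolding eq using eq ax(3) by (simp flip: mult_assoc)
  also have "\<dots> = y" using ay(2,3) by simp
  finally show ?thesis .
qed

text \<open>Expand the last a of a x a as x a a and collapse a x x to x; for x a x expand the last x
  as a x x and collapse x a a to a.\<close>

lemma core_inverse_of_inner:
  assumes "core_inverse_of a x"
  shows "a \<cdot> x \<cdot> a = a" and "x \<cdot> a \<cdot> x = x"
proof -
  note x = core_inverse_ofD(1,2)[OF assms]
  have "a \<cdot> x \<cdot> (x \<cdot> (a \<cdot> a)) = a \<cdot> (x \<cdot> x) \<cdot> (a \<cdot> a)" by (simp add: mult_assoc)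
  then show "a \<cdot> x \<cdot> a = a" unfolding x .
  have "x \<cdot> a \<cdot> (a \<cdot> (x \<cdot> x)) = x \<cdot> (a \<cdot> a) \<cdot> (x \<cdot> x)" by (simp add: mult_assoc)
  then show "x \<cdot> a \<cdot> x = x" unfolding x .
qed

text \<open>The projections a x and a y absorb each other by \<open>core_inverse_of_inner\<close>,
  hence agree; then x = x a y = x a a y y = a y y = y.\<close>

lemma core_inverse_of_unique:
  assumes x: "core_inverse_of a x" and y: "core_inverse_of a y"
  shows "x = y"
proof -
  have ax: "a \<cdot> x = a \<cdot> y"
    by (rule hermitian_eq_leftI[OF core_inverse_ofD(3)[OF x] core_inverse_ofD(3)[OF y]])
      (simp_all only: core_inverse_of_inner[OF x] core_inverse_of_inner[OF y] flip: mult_assoc)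
  have "x = x \<cdot> a \<cdot> y"
    using core_inverse_of_inner(2)[OF x] ax by (simp add: mult_assoc)
  also have "\<dots> = x \<cdot> a \<cdot> (a \<cdot> (y \<cdot> y))"
    unfolding core_inverse_ofD(2)[OF y] ..
  also have "\<dots> = x \<cdot> (a \<cdot> a) \<cdot> (y \<cdot> y)"
    by (simp add: mult_assoc)
  also have "\<dots> = y"
    unfolding core_inverse_ofD(1)[OF x] by (rule core_inverse_ofD(2)[OF y])
  finally show ?thesis .
qed

section \<open>Coincidences of the core inverse with other elements\<close>

lemma core_eq_mult_moore_penrose_iff_idempotent:
  assumes m: "moore_penrose_of a m" and c: "core_inverse_of a c"
  shows "c = a \<cdot> m \<longleftrightarrow> a \<cdot> a = a"
proof
  assume "c = a \<cdot> m"
  then have "a \<cdot> m \<cdot> (a \<cdot> a) = a" using core_inverse_ofD(1)[OF c] by simp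
  then have "a \<cdot> m \<cdot> a \<cdot> a = a" by (simp only: mult_assoc)
  then show "a \<cdot> a = a" unfolding moore_penrose_ofD(1)[OF m] .
next
  assume aa: "a \<cdot> a = a"
  then have "core_inverse_of a (a \<cdot> m)"
    unfolding core_inverse_of_def
    using moore_penrose_ofD(1,3)[OF m] by (simp flip: mult_assoc)
  with c show "c = a \<cdot> m" by (rule core_inverse_of_unique)
qed

lemma core_inverse_of_if_EP:
  assumes "moore_penrose_of a m" and "a \<cdot> m = m \<cdot> a"
  shows "core_inverse_of a m"
proof -
  note am = moore_penrose_ofD[OF assms(1)]
  have "m \<cdot> a \<cdot> a = a" using am(1) by (simp only: assms(2))
  moreover have "a \<cdot> m \<cdot> m = m" using am(2) by (simp only: assms(2))
  ultimately show ?thesis unfolding core_inverse_of_def mult_assoc using am(3) by blast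
qed

lemma group_inverse_of_if_EP:
  assumes "moore_penrose_of a m" and "a \<cdot> m = m \<cdot> a"
  shows "group_inverse_of a m"
  using assms unfolding moore_penrose_of_def group_inverse_of_def by blast

lemma core_eq_moore_penrose_iff_EP:
  assumes m: "moore_penrose_of a m" and c: "core_inverse_of a c"
  shows "c = m \<longleftrightarrow> a \<cdot> m = m \<cdot> a"
proof
  assume "c = m"
  note * = core_inverse_ofD(1,2)[OF c[unfolded this]]
  \<comment> \<open>The core equations make the hermitian elements a m and m a absorb each
    other.\<close>
  have "m \<cdot> a \<cdot> (a \<cdot> m) = m \<cdot> (a \<cdot> a) \<cdot> m" by (simp only: mult_assoc)
  also have "\<dots> = a \<cdot> m" unfolding * ..
  finally have 1: "m \<cdot> a \<cdot> (a \<cdot> m) = a \<cdot> m" .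
  have "a \<cdot> m \<cdot> (m \<cdot> a) = a \<cdot> (m \<cdot> m) \<cdot> a" by (simp only: mult_assoc)
  also have "\<dots> = m \<cdot> a" unfolding * ..
  finally have 2: "a \<cdot> m \<cdot> (m \<cdot> a) = m \<cdot> a" .
  show "a \<cdot> m = m \<cdot> a"
    by (rule hermitian_eq_leftI[OF moore_penrose_ofD(3,4)[OF m] 2 1])
next
  assume "a \<cdot> m = m \<cdot> a"
  then show "c = m"
    using core_inverse_of_unique[OF c core_inverse_of_if_EP[OF m]] by simp
qed

text \<open>A common value g satisfies all Penrose equations, since commutation carries the symmetry
  of a g over to g a. Conversely, under EP both inverses equal m.\<close>

lemma core_eq_group_iff_EP:
  assumes m: "moore_penrose_of a m" and c: "core_inverse_of a c" and g: "group_inverse_of a g"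
  shows "c = g \<longleftrightarrow> a \<cdot> m = m \<cdot> a"
proof
  assume "c = g"
  note c = c[unfolded this]
  note ag = group_inverse_ofD(3)[OF g]
  have "moore_penrose_of a g"
    unfolding moore_penrose_of_def
    using core_inverse_of_inner[OF c] core_inverse_ofD(3)[OF c] ag by simp
  then have "g = m" using m by (rule moore_penrose_of_unique)
  with ag show "a \<cdot> m = m \<cdot> a" by blast
next
  assume EP: "a \<cdot> m = m \<cdot> a"
  have "c = m" using core_eq_moore_penrose_iff_EP[OF m c] EP by simp
  also have "m = g" using group_inverse_of_unique[OF group_inverse_of_if_EP[OF m EP] g] .
  finally show "c = g" .
qed

text \<open>If c = a, then a is its own Moore-Penrose inverse. Conversely, a tripotent a is its own
  group inverse, and under EP the group inverse, m and c coincide.\<close>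

lemma core_eq_self_iff:
  assumes m: "moore_penrose_of a m" and c: "core_inverse_of a c"
  shows "c = a \<longleftrightarrow> a \<cdot> m = m \<cdot> a \<and> a \<cdot> a \<cdot> a = a"
proof
  assume "c = a"
  note c = c[unfolded this]
  note * = core_inverse_of_inner(1)[OF c] core_inverse_ofD(3)[OF c]
  have "moore_penrose_of a a"
    unfolding moore_penrose_of_def using * by blast
  with m have "m = a" by (rule moore_penrose_of_unique)
  with * show "a \<cdot> m = m \<cdot> a \<and> a \<cdot> a \<cdot> a = a" by simp
next
  assume *: "a \<cdot> m = m \<cdot> a \<and> a \<cdot> a \<cdot> a = a"
  then have "c = m" using core_eq_moore_penrose_iff_EP[OF m c] by simp
  have "group_inverse_of a a"
    unfolding group_inverse_of_def using * by blast
  with group_inverse_of_if_EP[OF m] * have "m = a" by (blast intro: group_inverse_of_unique)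
  with \<open>c = m\<close> show "c = a" by simp
qed

text \<open>For a partial isometry m = \<open>star a\<close>, which reduces the claim to
  \<open>core_eq_moore_penrose_iff_EP\<close>.\<close>

lemma core_eq_star_iff:
  assumes m: "moore_penrose_of a m" and c: "core_inverse_of a c"
  shows "c = star a \<longleftrightarrow> a \<cdot> m = m \<cdot> a \<and> a \<cdot> star a \<cdot> a = a"
proof -
  have *: "m = star a" if "a \<cdot> star a \<cdot> a = a"
  proof -
    have "star (a \<cdot> star a \<cdot> a) = star a" using that by simp
    then have "star a \<cdot> a \<cdot> star a = star a"
      by (simp add: star_mult star_star mult_assoc)
    with that have "moore_penrose_of a (star a)"
      by (simp add: moore_penrose_of_def star_mult star_star)
    with m show ?thesis by (rule moore_penrose_of_unique)
  qed
  show ?thesis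
  proof
    assume "c = star a"
    with core_inverse_of_inner(1)[OF c] have "a \<cdot> star a \<cdot> a = a" by simp
    with * core_eq_moore_penrose_iff_EP[OF m c] \<open>c = star a\<close>
    show "a \<cdot> m = m \<cdot> a \<and> a \<cdot> star a \<cdot> a = a" by blast
  next
    assume "a \<cdot> m = m \<cdot> a \<and> a \<cdot> star a \<cdot> a = a"
    with * core_eq_moore_penrose_iff_EP[OF m c] show "c = star a" by blast
  qed
qed

section \<open>Existence of the inverses from one-sided factorisations\<close>

lemma group_inverse_of_exists:
  assumes z: "a \<cdot> a \<cdot> z = a" and y: "y \<cdot> (a \<cdot> a) = a"
  shows "group_inverse_of a (y \<cdot> a \<cdot> z)"
proof -
  \<comment> \<open>Evaluating y a a z in two ways gives y a = a z; this element becomes the common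
    product of a with its group inverse.\<close>
  have "y \<cdot> (a \<cdot> a) \<cdot> z = y \<cdot> a"
    using z by (simp add: mult_assoc)
  then have yz: "y \<cdot> a = a \<cdot> z" using y by simp
  have 3: "a \<cdot> z \<cdot> a = a" using y by (simp flip: yz mult_assoc)
  have 1: "a \<cdot> (y \<cdot> a \<cdot> z) = a \<cdot> z"
    by (simp add: yz z flip: mult_assoc)
  have "y \<cdot> a \<cdot> z \<cdot> a = y \<cdot> (a \<cdot> z \<cdot> a)" by (simp add: mult_assoc)
  then have 2: "y \<cdot> a \<cdot> z \<cdot> a = a \<cdot> z" unfolding 3 using yz by simp
  have 4: "a \<cdot> z \<cdot> (y \<cdot> a \<cdot> z) = y \<cdot> a \<cdot> z" using 3 by (simp add: yz flip: mult_assoc)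
  show ?thesis
    unfolding group_inverse_of_def 1 2 using 3 4 by simp
qed

text \<open>Since a g a = a, the product of a with g a m is the hermitian projection a m; the other
  two equations follow from a g = g a.\<close>

lemma core_inverse_of_exists:
  assumes g: "group_inverse_of a g" and m: "moore_penrose_of a m"
  shows "core_inverse_of a (g \<cdot> a \<cdot> m)"
proof -
  note ga = group_inverse_ofD(3,1)[OF g]
  note am = moore_penrose_ofD[OF m]
  have 1: "a \<cdot> (g \<cdot> a \<cdot> m) = a \<cdot> m" using ga(2) by (simp flip: mult_assoc)
  have "g \<cdot> a \<cdot> m \<cdot> (a \<cdot> a) = g \<cdot> (a \<cdot> m \<cdot> a) \<cdot> a"
    by (simp add: mult_assoc)
  then have 2: "g \<cdot> a \<cdot> m \<cdot> (a \<cdot> a) = a"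
    unfolding am(1) ga(1)[symmetric] ga(2) .
  have "a \<cdot> m \<cdot> (g \<cdot> a \<cdot> m) = a \<cdot> m \<cdot> a \<cdot> g \<cdot> m"
    by (simp add: mult_assoc flip: ga(1))
  then have 3: "a \<cdot> m \<cdot> (g \<cdot> a \<cdot> m) = g \<cdot> a \<cdot> m"
    unfolding am(1) ga(1) .
  show ?thesis
    unfolding core_inverse_of_def using 1 2 3 am(3) by (simp flip: mult_assoc)
qed

text \<open>The first hypothesis makes \<open>star y\<close> an inner inverse with a
  \<open>star y\<close> hermitian, the second makes \<open>star w\<close> an inner inverse with
  \<open>star w\<close> a hermitian. Placing a between them combines both symmetries.\<close>

lemma moore_penrose_of_exists:
  assumes y: "y \<cdot> (star a \<cdot> a) = a" and w: "a \<cdot> star a \<cdot> w = a"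
  shows "moore_penrose_of a (star w \<cdot> a \<cdot> star y)"
proof -
  have "star a \<cdot> a \<cdot> star y = star a"
    using arg_cong[OF y, of star] by (simp add: star_mult star_star mult_assoc)
  then have "y \<cdot> (star a \<cdot> a) \<cdot> star y = y \<cdot> star a" by (simp add: mult_assoc)
  then have y1: "a \<cdot> star y = y \<cdot> star a" unfolding y .
  have y2: "star (a \<cdot> star y) = a \<cdot> star y" by (simp add: star_mult star_star y1)
  have y3: "a \<cdot> star y \<cdot> a = a" using y y1 by (simp add: mult_assoc)
  have "star w \<cdot> (a \<cdot> star a) = star a"
    using arg_cong[OF w, of star] by (simp add: star_mult star_star mult_assoc)
  then have "star w \<cdot> (a \<cdot> star a \<cdot> w) = star a \<cdot> w" by (simp flip: mult_assoc)
  then have w1: "star w \<cdot> a = star a \<cdot> w" unfolding w .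
  have w2: "star (star w \<cdot> a) = star w \<cdot> a" by (simp add: star_mult star_star w1)
  have w3: "a \<cdot> star w \<cdot> a = a" using w w1 by (simp add: mult_assoc)
  have 1: "a \<cdot> (star w \<cdot> a \<cdot> star y) = a \<cdot> star y" using w3 by (simp flip: mult_assoc)
  have 2: "star w \<cdot> a \<cdot> star y \<cdot> a = star w \<cdot> a" using y3 by (simp add: mult_assoc)
  have 3: "star w \<cdot> a \<cdot> (star w \<cdot> a \<cdot> star y) = star w \<cdot> a \<cdot> star y"
    using 1 by (simp add: mult_assoc)
  show ?thesis
    unfolding moore_penrose_of_def 1 2 using 3 y2 y3 w2 by simp
qed

end

section \<open>Tensors under the Einstein product\<close>

lemma finite_multi_indices [simp]: "finite (multi_indices I)"
  using set_col_major[of I] by (metis List.finite_set)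

lemma einstein_assoc: "einstein I (einstein I A B) C = einstein I A (einstein I B C)"
  unfolding einstein_def
  by (intro ext) (simp add: sum_distrib_left sum_distrib_right mult.assoc, rule sum.swap)

lemma conj_transpose_einstein:
  "conj_transpose (einstein I A B) = einstein I (conj_transpose B) (conj_transpose A)"
  unfolding einstein_def conj_transpose_def by (intro ext) (simp add: mult.commute)

text \<open>The carrier is the whole type \<open>tensor\<close>; membership in
  \<open>tensors I\<close> is tracked separately for each constructed inverse.\<close>

interpretation tensor: involutive_semigroup "einstein I" conj_transpose for I
  by unfold_locales (simp_all add: einstein_assoc conj_transpose_einstein,
    simp add: conj_transpose_def)

lemma einstein_mem [simp]: "A \<in> tensors I \<Longrightarrow> B \<in> tensors I \<Longrightarrow> einstein I A B \<in> tensors I"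
  by (auto simp: tensors_def einstein_def)

lemma conj_transpose_mem [simp]: "A \<in> tensors I \<Longrightarrow> conj_transpose A \<in> tensors I"
  by (auto simp: tensors_def conj_transpose_def)

lemma tensor_one_mem [simp]: "tensor_one I \<in> tensors I"
  by (auto simp: tensors_def tensor_one_def)

lemma add_mem [simp]: "A \<in> tensors I \<Longrightarrow> B \<in> tensors I \<Longrightarrow> A + B \<in> tensors I"
  by (auto simp: tensors_def)

lemma diff_mem [simp]: "A \<in> tensors I \<Longrightarrow> B \<in> tensors I \<Longrightarrow> A - B \<in> tensors I"
  by (auto simp: tensors_def)

lemma einstein_one_right [simp]: "A \<in> tensors I \<Longrightarrow> einstein I A (tensor_one I) = A"
  by (auto simp: tensors_def einstein_def tensor_one_def fun_eq_iff if_distrib sum.If_cases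
      cong: if_cong)

lemma einstein_one_left [simp]:
  assumes "A \<in> tensors I"
  shows "einstein I (tensor_one I) A = A"
proof (intro ext)
  fix i j
  have "einstein I (tensor_one I) A i j = (\<Sum>k\<in>multi_indices I. if k = i then A i j else 0)"
    unfolding einstein_def by (intro sum.cong) (auto simp: tensor_one_def)
  also have "\<dots> = A i j" using assms by (simp add: tensors_def)
  finally show "einstein I (tensor_one I) A i j = A i j" .
qed

lemma einstein_distrib:
  "einstein I (A + B) C = einstein I A C + einstein I B C"
  "einstein I C (A + B) = einstein I C A + einstein I C B"
  "einstein I (A - B) C = einstein I A C - einstein I B C"
  "einstein I C (A - B) = einstein I C A - einstein I C B"
  by (simp_all add: einstein_def fun_eq_iff algebra_simps sum.distrib sum_subtractf)

lemma einstein_zero [simp]: "einstein I 0 A = 0" "einstein I A 0 = 0"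
  by (simp_all add: einstein_def fun_eq_iff)

lemma tensor_pow_2: "A \<in> tensors I \<Longrightarrow> tensor_pow I A 2 = einstein I A A"
  by (simp add: numeral_2_eq_2)

lemma tensor_pow_3: "A \<in> tensors I \<Longrightarrow> tensor_pow I A 3 = einstein I (einstein I A A) A"
  by (simp add: numeral_3_eq_3)

section \<open>Inner inverses and the Moore-Penrose inverse\<close>

lemma sum_fun_apply: "(\<Sum>x\<in>S. f x) y = (\<Sum>x\<in>S. f x y :: 'a::comm_monoid_add)"
  by (induction S rule: infinite_finite_induct) simp_all

lemma tensor_inner_inverse_exists:
  assumes A: "A \<in> tensors I"
  obtains G where "G \<in> tensors I" "einstein I (einstein I A G) A = A"
proof -
  let ?M = "multi_indices I"
  define s where "s = (\<lambda>(c::complex) (f::nat list \<Rightarrow> complex) x. c * f x)"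
  interpret vector_space s
    by unfold_locales (auto simp: s_def fun_eq_iff algebra_simps)
  interpret vector_space_pair s s ..
  \<comment> \<open>The map f acts on all functions but reads only the coordinates in
    \<open>?M\<close>.\<close>
  define f where "f = (\<lambda>v i. \<Sum>k\<in>?M. A i k * v k)"
  have lin_f: "Vector_Spaces.linear s s f"
    unfolding Vector_Spaces.linear_iff
    by (intro conjI vector_space_axioms)
      (auto simp: f_def s_def fun_eq_iff algebra_simps sum.distrib sum_distrib_left)
  \<comment> \<open>g is a linear section of f on the range of f.\<close>
  obtain g where lin_g: "Vector_Spaces.linear s s g" and g: "\<And>v. f (g (f v)) = f v"
    using linear_exists_right_inverse_on[OF lin_f subspace_UNIV] by blast
  interpret g: Vector_Spaces.linear s s g by fact
  define e where "e = (\<lambda>(j::nat list) k. if k = j then 1 else 0 :: complex)"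
  \<comment> \<open>The matrix of g, cut off outside \<open>?M\<close> so that it is a tensor; f
    never reads the coordinates k that are cut off.\<close>
  define G where "G = (\<lambda>k l. if k \<in> ?M \<and> l \<in> ?M then g (e l) k else 0)"
  \<comment> \<open>A vector supported on the finite set \<open>?M\<close> is a finite combination
    of the unit vectors \<open>e l\<close>, so linearity determines g there.\<close>
  have G: "(\<Sum>l\<in>?M. G k l * w l) = g w k" if "k \<in> ?M" "\<And>l. l \<notin> ?M \<Longrightarrow> w l = 0" for w k
  proof -
    have "w x = (\<Sum>l\<in>?M. s (w l) (e l)) x" for x
    proof -
      have "(\<Sum>l\<in>?M. s (w l) (e l)) x = (\<Sum>l\<in>?M. if l = x then w x else 0)"
        unfolding sum_fun_apply by (intro sum.cong) (auto simp: s_def e_def)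
      also have "\<dots> = w x" using that(2) by simp
      finally show ?thesis ..
    qed
    then have "w = (\<Sum>l\<in>?M. s (w l) (e l))" by (rule ext)
    from arg_cong[OF this, of g] have "g w = (\<Sum>l\<in>?M. s (w l) (g (e l)))"
      by (simp only: g.sum g.scale)
    then show ?thesis
      using that(1) by (simp add: sum_fun_apply s_def G_def mult.commute)
  qed
  \<comment> \<open>Column j of A is the image of a unit vector, hence in the range of f, where g is
    a section. For j outside \<open>?M\<close> both sides vanish.\<close>
  have fe: "f (e j) = (\<lambda>i. A i j)" for j
  proof
    fix i
    have "f (e j) i = (\<Sum>k\<in>?M. if k = j then A i j else 0)"
      unfolding f_def by (intro sum.cong) (auto simp: e_def)
    also have "\<dots> = A i j" using A by (simp add: tensors_def)
    finally show "f (e j) i = A i j" .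
  qed
  have "einstein I A (einstein I G A) i j = A i j" for i j
  proof -
    have "einstein I A (einstein I G A) i j = (\<Sum>k\<in>?M. A i k * g (\<lambda>l. A l j) k)"
      unfolding einstein_def using A by (intro sum.cong refl) (subst G, auto simp: tensors_def)
    also have "\<dots> = f (g (f (e j))) i" unfolding fe by (simp add: f_def)
    also have "\<dots> = A i j" unfolding g by (simp add: fe)
    finally show ?thesis .
  qed
  then have "einstein I (einstein I A G) A = A" by (simp add: einstein_assoc fun_eq_iff)
  moreover have "G \<in> tensors I" by (auto simp: tensors_def G_def)
  ultimately show thesis using that by blast
qed

text \<open>The i-th diagonal entry of the product is the sum of the squared moduli in column i of
  A.\<close>

lemma conj_transpose_mult_self_eq_0:
  assumes "A \<in> tensors I" and "einstein I (conj_transpose A) A = 0"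
  shows "A = 0"
proof -
  have "A k i = 0" if "k \<in> multi_indices I" for k i
  proof -
    have "(\<Sum>k\<in>multi_indices I. cnj (A k i) * A k i) = 0"
      using fun_cong[OF fun_cong[OF assms(2)], of i i] by (simp add: einstein_def conj_transpose_def)
    then have "(\<Sum>k\<in>multi_indices I. complex_of_real ((cmod (A k i))\<^sup>2)) = 0"
      by (simp only: complex_norm_square mult.commute)
    then have "(\<Sum>k\<in>multi_indices I. (cmod (A k i))\<^sup>2) = 0"
      by (metis of_real_eq_0_iff of_real_sum)
    with that show ?thesis by (simp add: sum_nonneg_eq_0_iff)
  qed
  with assms(1) show ?thesis by (auto simp: tensors_def fun_eq_iff)
qed

lemma conj_transpose_diff: "conj_transpose (A - B) = conj_transpose A - conj_transpose B"
  by (simp add: conj_transpose_def fun_eq_iff)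

text \<open>Supplies the factors for \<open>moore_penrose_of_exists\<close>. The witness is A G,
  with G an inner inverse of the Gram tensor.\<close>

lemma tensor_gram_left_factor:
  assumes A: "A \<in> tensors I"
  obtains Y where "Y \<in> tensors I" "einstein I Y (einstein I (conj_transpose A) A) = A"
proof -
  define H where "H = einstein I (conj_transpose A) A"
  have H: "H \<in> tensors I" using A by (simp add: H_def)
  from tensor_inner_inverse_exists[OF H] obtain G
    where G: "G \<in> tensors I" and HGH: "einstein I (einstein I H G) H = H" by blast
  \<comment> \<open>Subtracting A is harmless: A* T = H G H - H = 0, whence T* T = 0.\<close>
  define T where "T = einstein I (einstein I A G) H - A"
  have T: "T \<in> tensors I" using A G H by (simp add: T_def)
  have AT: "einstein I (conj_transpose A) T = 0"
    using HGH by (simp add: T_def einstein_distrib H_def einstein_assoc)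
  \<comment> \<open>Both summands of \<open>conj_transpose T\<close> end in the factor
    \<open>conj_transpose A\<close>, which annihilates T.\<close>
  have "einstein I (conj_transpose T) T = 0"
    using AT unfolding T_def[THEN arg_cong, of conj_transpose]
    by (simp add: conj_transpose_diff conj_transpose_einstein einstein_distrib einstein_assoc)
  then have "T = 0" using T by (rule conj_transpose_mult_self_eq_0[rotated])
  then have "einstein I (einstein I A G) H = A" by (simp add: T_def)
  with that[of "einstein I A G"] A G show thesis by (simp add: H_def)
qed

lemma tensor_moore_penrose_exists:
  assumes A: "A \<in> tensors I"
  obtains M where "M \<in> tensors I" "tensor.moore_penrose_of I A M"
proof -
  obtain Y where Y: "Y \<in> tensors I" "einstein I Y (einstein I (conj_transpose A) A) = A"
    using tensor_gram_left_factor[OF A] by blast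
  obtain W where W: "W \<in> tensors I"
      "einstein I W (einstein I A (conj_transpose A)) = conj_transpose A"
    using tensor_gram_left_factor[OF conj_transpose_mem[OF A]] by (auto simp: tensor.star_star)
  \<comment> \<open>The adjoint of the equation for W is the second hypothesis of
    \<open>moore_penrose_of_exists\<close>, with w the adjoint of W.\<close>
  have "einstein I (einstein I A (conj_transpose A)) (conj_transpose W) = A"
    using arg_cong[OF W(2), of conj_transpose]
    by (simp add: conj_transpose_einstein tensor.star_star)
  from tensor.moore_penrose_of_exists[OF Y(2) this]
  have "tensor.moore_penrose_of I A (einstein I (einstein I W A) (conj_transpose Y))"
    by (simp add: tensor.star_star)
  with A Y(1) W(1) show thesis by (intro that) simp_all
qed

section \<open>The rank condition\<close>

text \<open>The column space of M N lies in that of M and has the same dimension, so the two agree;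
  each column of M is then M N applied to a vector, and these vectors are the columns of Z.\<close>

lemma (in vec_space) mult_right_factor_if_rank_eq:
  assumes M: "M \<in> carrier_mat n k" and N: "N \<in> carrier_mat k m" and rk: "rank (M * N) = rank M"
  obtains Z where "Z \<in> carrier_mat m k" "M * N * Z = M"
proof -
  have MN: "M * N \<in> carrier_mat n m" using M N by simp
  let ?V = "span (set (cols M))"
  have cM: "set (cols M) \<subseteq> carrier_vec n" and cMN: "set (cols (M * N)) \<subseteq> carrier_vec n"
    using cols_dim M MN by blast+
  have sub: "set (cols (M * N)) \<subseteq> ?V"
  proof
    fix v assume "v \<in> set (cols (M * N))"
    then obtain j where "j < m" "v = col (M * N) j"
      using MN by (metis carrier_matD(2) cols_length cols_nth in_set_conv_nth)
    then have "v = M *\<^sub>v col N j" by (simp only: col_mult2[OF M N])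
    then show "v \<in> ?V"
      using col_space_eq[OF M] M N \<open>j < m\<close> unfolding col_space_def by auto
  qed
  obtain T where T: "maximal T (\<lambda>T. T \<subseteq> set (cols (M * N)) \<and> lin_indpt T)"
    using maximal_exists[of "(\<lambda>T. T \<subseteq> set (cols (M * N)) \<and> lin_indpt T)"
        "card (set (cols (M * N)))" "{}"]
    by (meson List.finite_set card_mono empty_iff empty_subsetI finite_lin_indpt2 rev_finite_subset)
  then have T1: "T \<subseteq> set (cols (M * N))" "lin_indpt T" by (auto simp: maximal_def)
  have card: "card T = rank M" using rank_card_indpt[OF MN T] rk by simp
  have subm: "submodule class_ring ?V V" using cM by (simp add: span_is_submodule)
  have vs: "vectorspace class_ring (vs ?V)"
    using span_is_subspace[THEN subspace_is_vs] cM by auto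
  have TV: "T \<subseteq> ?V" using T1(1) sub by blast
  \<comment> \<open>T consists of independent columns of M N, and its size \<open>rank M\<close> is
    the dimension of \<open>?V\<close>.\<close>
  have "vectorspace.basis class_ring (vs ?V) T"
  proof (rule vectorspace.dim_li_is_basis[OF vs])
    show "vectorspace.fin_dim class_ring (vs ?V)" by (rule fin_dim_span_cols[OF M])
    show "finite T" using T1(1) by (rule finite_subset) simp
    show "T \<subseteq> carrier (vs ?V)" using TV by simp
    show "LinearCombinations.module.lin_indpt class_ring (vs ?V) T"
      using span_li_not_depend(2)[OF TV subm] T1(2) by simp
    show "vectorspace.dim class_ring (vs ?V) \<le> card T"
      using card by (simp add: rank_def)
  qed
  then have "span T = ?V"
    using span_li_not_depend(1)[OF TV subm] by (simp add: vectorspace.basis_def[OF vs])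
  then have V: "?V \<subseteq> span (set (cols (M * N)))"
    using span_is_monotone[OF T1(1)] by simp
  have "\<exists>x\<in>carrier_vec m. M * N *\<^sub>v x = col M j" if "j < k" for j
  proof -
    have "col M j \<in> ?V"
      using that M cM span_mem by (metis carrier_matD(2) cols_length cols_nth nth_mem)
    with V show ?thesis using col_space_eq[OF MN] MN N unfolding col_space_def by auto
  qed
  then obtain x where x: "\<And>j. j < k \<Longrightarrow> x j \<in> carrier_vec m"
      "\<And>j. j < k \<Longrightarrow> M * N *\<^sub>v x j = col M j"
    by metis
  define Z where "Z = mat m k (\<lambda>(i, j). x j $ i)"
  have Z: "Z \<in> carrier_mat m k" by (simp add: Z_def)
  have colZ: "col Z j = x j" if "j < k" for j
    using x(1)[OF that] that by (intro eq_vecI) (simp_all add: Z_def)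
  have "M * N * Z = M"
  proof (rule mat_col_eqI)
    fix j assume "j < dim_col M"
    then have j: "j < k" using M by simp
    show "col (M * N * Z) j = col M j"
      unfolding col_mult2[OF MN Z j] colZ[OF j] by (rule x(2)[OF j])
  qed (use M MN Z in simp_all)
  with Z that show thesis by blast
qed

section \<open>Transfer between tensors and square matrices\<close>

lemma rsh_carrier [simp]: "rsh I A \<in> carrier_mat (prod_list I) (prod_list I)"
  by (simp add: rsh_def)

lemma rsh_einstein: "rsh I (einstein I A B) = rsh I A * rsh I B"
proof (rule eq_matI)
  fix p q assume pq: "p < dim_row (rsh I A * rsh I B)" "q < dim_col (rsh I A * rsh I B)"
  \<comment> \<open>\<open>col_major I\<close> lists each multi-index exactly once, so summing over
    positions is summing over multi-indices.\<close>
  have "(\<Sum>k\<in>multi_indices I. f k) = (\<Sum>r<prod_list I. f (col_major I ! r))" for f :: "_ \<Rightarrow> complex"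
    using sum.reindex_bij_betw[OF bij_betw_nth[OF distinct_col_major[of I] refl refl], of f]
    by (simp add: set_col_major length_col_major)
  with pq show "rsh I (einstein I A B) $$ (p, q) = (rsh I A * rsh I B) $$ (p, q)"
    by (simp add: rsh_def einstein_def scalar_prod_def atLeast0LessThan)
qed (simp_all add: rsh_def)

lemma rsh_inject:
  assumes "A \<in> tensors I" "B \<in> tensors I" "rsh I A = rsh I B"
  shows "A = B"
proof (intro ext)
  fix i j
  show "A i j = B i j"
  proof (cases "i \<in> multi_indices I \<and> j \<in> multi_indices I")
    case True
    then obtain p q where "p < prod_list I" "i = col_major I ! p" "q < prod_list I" "j = col_major I ! q"
      by (metis in_set_conv_nth length_col_major set_col_major)
    with arg_cong[OF assms(3), of "\<lambda>M. M $$ (p, q)"] show ?thesis by (simp add: rsh_def)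
  qed (use assms in \<open>auto simp: tensors_def\<close>)
qed

lemma rsh_one: "rsh I (tensor_one I) = 1\<^sub>m (prod_list I)"
  using distinct_col_major[of I] nth_mem[of _ "col_major I"]
  by (intro eq_matI) (auto simp: rsh_def tensor_one_def nth_eq_iff_index_eq length_col_major
      set_col_major)

lemma tensor_left_inverse_if_right_inverse:
  assumes "U \<in> tensors I" "V \<in> tensors I" "einstein I U V = tensor_one I"
  shows "einstein I V U = tensor_one I"
  using assms mat_mult_left_right_inverse[of "rsh I U" "prod_list I" "rsh I V"]
  by (intro rsh_inject[of _ I]) (simp_all add: rsh_one flip: rsh_einstein)

section \<open>Factoring A through its square on either side\<close>

lemma core_tensor_right_factor:
  assumes A: "A \<in> tensors I" and core: "core_tensor I A"
  obtains Z where "Z \<in> tensors I" "einstein I (einstein I A A) Z = A"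
proof -
  let ?n = "prod_list I" and ?B = "einstein I A A"
  have B: "?B \<in> tensors I" using A by simp
  have "vec_space.rank ?n (rsh I A * rsh I A) = vec_space.rank ?n (rsh I A)"
    using core A by (simp add: core_tensor_def rshrank_def tensor_pow_2 rsh_einstein)
  from vec_space.mult_right_factor_if_rank_eq[OF rsh_carrier rsh_carrier this]
  obtain Z where Z: "Z \<in> carrier_mat ?n ?n" "rsh I ?B * Z = rsh I A"
    unfolding rsh_einstein by blast
  \<comment> \<open>The matrix Z is replaced by the tensor G A: with B = A A, reshaping gives B G A
    = B G B Z = B Z = A.\<close>
  from tensor_inner_inverse_exists[OF B] obtain G
    where G: "G \<in> tensors I" "einstein I (einstein I ?B G) ?B = ?B" by blast
  have "rsh I (einstein I (einstein I ?B G) A) = rsh I ?B * rsh I G * (rsh I ?B * Z)"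
    unfolding Z(2) by (simp only: rsh_einstein)
  also have "\<dots> = rsh I (einstein I (einstein I ?B G) ?B) * Z"
    unfolding rsh_einstein[of I "einstein I ?B G"] rsh_einstein[of I ?B G]
    by (rule assoc_mult_mat[OF mult_carrier_mat[OF rsh_carrier rsh_carrier] rsh_carrier Z(1), symmetric])
  also have "\<dots> = rsh I A" unfolding G(2) by (rule Z(2))
  finally have "einstein I (einstein I ?B G) A = A"
    using A G(1) by (intro rsh_inject[of _ I]) simp_all
  then have "einstein I ?B (einstein I G A) = A" by (simp only: einstein_assoc)
  with A G(1) show thesis by (intro that) simp_all
qed

text \<open>With N an inner inverse of A, the tensor U = A + 1 - A N has the right inverse V, so V U = 1;
  since (1 - A N) A = 0, this yields A = V U A = V A^2.\<close>

lemma tensor_left_factor_if_right_factor: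
  assumes A: "A \<in> tensors I" and Z: "Z \<in> tensors I" and AZ: "einstein I (einstein I A A) Z = A"
  obtains Y where "Y \<in> tensors I" "einstein I Y (einstein I A A) = A"
proof -
  from tensor_inner_inverse_exists[OF A] obtain N
    where N: "N \<in> tensors I" and ANA: "einstein I (einstein I A N) A = A" by blast
  define E where "E = einstein I A N"
  define F where "F = tensor_one I - E"
  \<comment> \<open>Chosen so that A W = A A Z N = A N = E.\<close>
  define W where "W = einstein I (einstein I A Z) N"
  define U where "U = A + F"
  \<comment> \<open>W + F alone leaves the cross term A F in U V; the last summand cancels it,
    because A W A F = E A F = A F and F W = 0.\<close>
  define V where "V = W + F - einstein I W (einstein I A F)"
  have [simp]: "E \<in> tensors I" "F \<in> tensors I" "W \<in> tensors I" "U \<in> tensors I" "V \<in> tensors I"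
    using A N Z by (simp_all add: E_def F_def W_def U_def V_def)
  have EA: "einstein I E A = A" using ANA by (simp add: E_def)
  have FA: "einstein I F A = 0" using EA A by (simp add: F_def einstein_distrib)
  have AW: "einstein I A W = E" using AZ by (simp add: W_def E_def flip: einstein_assoc)
  have FW: "einstein I F W = 0" using FA by (simp add: W_def flip: einstein_assoc)
  have "einstein I E E = E" using EA by (simp add: E_def flip: einstein_assoc)
  then have FF: "einstein I F F = F" by (simp add: F_def einstein_distrib)
  have AWAF: "einstein I A (einstein I W (einstein I A F)) = einstein I A F"
    using AW EA by (simp flip: einstein_assoc)
  have FWAF: "einstein I F (einstein I W (einstein I A F)) = 0"
    using FW by (simp flip: einstein_assoc)
  have "einstein I U V = E + F"
    by (simp add: U_def V_def einstein_distrib AW FW FF AWAF FWAF)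
  then have "einstein I U V = tensor_one I" by (simp add: F_def)
  then have VU: "einstein I V U = tensor_one I"
    by (rule tensor_left_inverse_if_right_inverse[rotated 2]) simp_all
  have "einstein I V (einstein I A A) = einstein I V (einstein I U A)"
    using FA by (simp add: U_def einstein_distrib)
  also have "\<dots> = A" using VU A by (simp flip: einstein_assoc)
  finally show thesis by (intro that[of V]) simp_all
qed

section \<open>Instantiation for the given tensor\<close>

lemma is_moore_penrose_iff:
  "is_moore_penrose I A X \<longleftrightarrow> X \<in> tensors I \<and> tensor.moore_penrose_of I A X"
  by (simp add: is_moore_penrose_def tensor.moore_penrose_of_def)

lemma is_group_inverse_iff:
  "is_group_inverse I A X \<longleftrightarrow> X \<in> tensors I \<and> tensor.group_inverse_of I A X"
  by (simp add: is_group_inverse_def tensor.group_inverse_of_def)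

lemma is_core_inverse_iff:
  "A \<in> tensors I \<Longrightarrow> is_core_inverse I A X \<longleftrightarrow> X \<in> tensors I \<and> tensor.core_inverse_of I A X"
  by (auto simp: is_core_inverse_def tensor.core_inverse_of_def tensor_pow_2)

theorem theorem3p5:
  fixes I :: "nat list" and A :: tensor
  assumes "I \<noteq> []" and "\<forall>d\<in>set I. 0 < d"
    and "A \<in> tensors I" and "core_tensor I A"
  shows "(core_inverse I A = tensor_zero \<longleftrightarrow> A = tensor_zero) \<and>
    (core_inverse I A = einstein I A (moore_penrose I A) \<longleftrightarrow> idempotent_tensor I A) \<and>
    (core_inverse I A = moore_penrose I A \<longleftrightarrow> EP_tensor I A) \<and>
    (core_inverse I A = group_inverse I A \<longleftrightarrow> EP_tensor I A) \<and>
    (core_inverse I A = A \<longleftrightarrow> EP_tensor I A \<and> tripotent_tensor I A) \<and>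
    (core_inverse I A = conj_transpose A \<longleftrightarrow> EP_tensor I A \<and> partial_isometry_tensor I A)"
proof -
  note A = assms(3)
  obtain M where M: "M \<in> tensors I" "tensor.moore_penrose_of I A M"
    using tensor_moore_penrose_exists[OF A] by blast
  obtain Z where Z: "Z \<in> tensors I" "einstein I (einstein I A A) Z = A"
    using core_tensor_right_factor[OF A assms(4)] by blast
  obtain Y where Y: "Y \<in> tensors I" "einstein I Y (einstein I A A) = A"
    using tensor_left_factor_if_right_factor[OF A Z] by blast
  define G where "G = einstein I (einstein I Y A) Z"
  define C where "C = einstein I (einstein I G A) M"
  have G: "G \<in> tensors I" "tensor.group_inverse_of I A G"
    using A Y Z tensor.group_inverse_of_exists[OF Z(2) Y(2)] by (simp_all add: G_def)
  have C: "C \<in> tensors I" "tensor.core_inverse_of I A C"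
    using A G M tensor.core_inverse_of_exists[OF G(2) M(2)] by (simp_all add: C_def)
  \<comment> \<open>Uniqueness identifies each definite description with the inverse constructed
    above.\<close>
  have M_eq: "moore_penrose I A = M"
    unfolding moore_penrose_def using M tensor.moore_penrose_of_unique
    by (intro the_equality) (auto simp: is_moore_penrose_iff)
  have G_eq: "group_inverse I A = G"
    unfolding group_inverse_def using G tensor.group_inverse_of_unique
    by (intro the_equality) (auto simp: is_group_inverse_iff)
  have C_eq: "core_inverse I A = C"
    unfolding core_inverse_def using C tensor.core_inverse_of_unique
    by (intro the_equality) (auto simp: is_core_inverse_iff[OF A])
  \<comment> \<open>Immediate from A = C A A and C = A C C.\<close>
  have "C = 0 \<longleftrightarrow> A = 0"
    using C(2) by (metis tensor.core_inverse_of_def einstein_zero)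
  moreover have "tensor_zero = 0" by (simp add: tensor_zero_def fun_eq_iff)
  ultimately show ?thesis
    unfolding M_eq G_eq C_eq EP_tensor_def idempotent_tensor_def tripotent_tensor_def
      partial_isometry_tensor_def tensor_pow_2[OF A] tensor_pow_3[OF A]
    using tensor.core_eq_mult_moore_penrose_iff_idempotent[OF M(2) C(2)]
      tensor.core_eq_moore_penrose_iff_EP[OF M(2) C(2)]
      tensor.core_eq_group_iff_EP[OF M(2) C(2) G(2)]
      tensor.core_eq_self_iff[OF M(2) C(2)] tensor.core_eq_star_iff[OF M(2) C(2)]
    by simp
qed

end
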